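(* Let $x=\{x_{jk}\}_{j,k\in\mathbb{N}}$ be a double sequence in the normed linear space $X$ and let $r\ge 0$ be a real number. Then the rough $I$-statistical limit set $I\text{-}st\text{-}\mathrm{LIM}_x^r$ of $x$ is a convex set.
   Context: Let $\mathbb{N}=\{1,2,3,\dots\}$ and let $(X,\|\cdot\|)$ be a normed linear space. An ideal $I$ on $\mathbb{N}\times\mathbb{N}$ is a class of subsets of $\mathbb{N}\times\mathbb{N}$ with $\emptyset\in I$, closed under finite unions and under taking subsets; it is nontrivial if $\mathbb{N}\times\mathbb{N}\notin I$. A nontrivial ideal $I$ on $\mathbb{N}\times\mathbb{N}$ is strongly admissible if $\{i\}\times\mathbb{N}\in I$ and $\mathbb{N}\times\{i\}\in I$ for every $i\in\mathbb{N}$. Throughout, $I$ is a fixed strongly admissible ideal on $\mathbb{N}\times\mathbb{N}$. For a double sequence $x=\{x_{jk}\}_{j,k\in\mathbb{N}}$ in $X$, a real number $r\ge 0$ and $\xi\in X$, $x$ is rough $I$-statistically convergent to $\xi$ with roughness degree $r$ ($\xi$ is a rough $I$-statistical limit of $x$) if for all $\varepsilon>0$ and $\delta>0$ $$\Big\{(m,n)\in\mathbb{N}\times\mathbb{N}:\ \tfrac{1}{mn}\big|\{(j,k): j\le m,\ k\le n,\ \|x_{jk}-\xi\|\ge r+\varepsilon\}\big|\ge\delta\Big\}\in I .$$ $I\text{-}st\text{-}\mathrm{LIM}_x^r$ denotes the set of all such $\xi\in X$ (it may be empty). *)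

theory Defs
  imports "HOL-Analysis.Analysis"
begin

(* Indices start at 1, so the index set is pos_nats and not UNIV; a double sequence is
   a function of type nat => nat => 'a of which only the values at positive indices are used. *)

abbreviation pos_nats :: "nat set"
  where "pos_nats \<equiv> {1..}"

definition set_ideal_on :: "'b set \<Rightarrow> 'b set set \<Rightarrow> bool"
  where "set_ideal_on S I \<longleftrightarrow>
    I \<subseteq> Pow S \<and>
    {} \<in> I \<and>
    (\<forall>A\<in>I. \<forall>B\<in>I. A \<union> B \<in> I) \<and>
    (\<forall>A\<in>I. \<forall>B. B \<subseteq> A \<longrightarrow> B \<in> I)"

definition nontrivial_ideal_on :: "'b set \<Rightarrow> 'b set set \<Rightarrow> bool"
  where "nontrivial_ideal_on S I \<longleftrightarrow> set_ideal_on S I \<and> S \<notin> I"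

definition strongly_admissible_ideal :: "(nat \<times> nat) set set \<Rightarrow> bool"
  where "strongly_admissible_ideal I \<longleftrightarrow>
    nontrivial_ideal_on (pos_nats \<times> pos_nats) I \<and>
    (\<forall>i\<in>pos_nats. {i} \<times> pos_nats \<in> I \<and> pos_nats \<times> {i} \<in> I)"

definition rough_I_statistically_convergent ::
    "(nat \<times> nat) set set \<Rightarrow> real \<Rightarrow> (nat \<Rightarrow> nat \<Rightarrow> 'a::real_normed_vector) \<Rightarrow> 'a \<Rightarrow> bool"
  where "rough_I_statistically_convergent I r x \<xi> \<longleftrightarrow>
    (\<forall>\<epsilon>>0. \<forall>\<delta>>0.
      {(m, n) \<in> pos_nats \<times> pos_nats.
        1 / (real m * real n) *
          real (card {(j, k) \<in> pos_nats \<times> pos_nats.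
                        j \<le> m \<and> k \<le> n \<and> norm (x j k - \<xi>) \<ge> r + \<epsilon>}) \<ge> \<delta>} \<in> I)"

definition I_st_LIM ::
    "(nat \<times> nat) set set \<Rightarrow> real \<Rightarrow> (nat \<Rightarrow> nat \<Rightarrow> 'a::real_normed_vector) \<Rightarrow> 'a set"
  where "I_st_LIM I r x = {\<xi>. rough_I_statistically_convergent I r x \<xi>}"

end

theory Submission
  imports Defs
begin

text \<open>
  Let \<open>\<xi>\<close> be a convex combination of two rough limits \<open>a\<close> and \<open>b\<close>. Balls being convex, an index
  pair \<open>(j, k)\<close> with \<open>\<parallel>x\<^sub>j\<^sub>k - \<xi>\<parallel> \<ge> r + \<epsilon>\<close> satisfies the same inequality with \<open>a\<close> or with \<open>b\<close>
  in place of \<open>\<xi>\<close>. Hence the density of such pairs in \<open>[1,m] \<times> [1,n]\<close> is at most the sum of the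
  densities for \<open>a\<close> and for \<open>b\<close>, and wherever it is at least \<open>\<delta>\<close>, one of the two summands is at
  least \<open>\<delta>/2\<close>. The set of \<open>(m, n)\<close> to be shown small is therefore contained in the union of two
  members of the ideal.
\<close>

text \<open>The index pairs in \<open>[1,m] \<times> [1,n]\<close> at which \<open>x\<close> has distance at least \<open>s\<close> from \<open>\<xi>\<close>.\<close>

definition far_pairs ::
    "(nat \<Rightarrow> nat \<Rightarrow> 'a::real_normed_vector) \<Rightarrow> 'a \<Rightarrow> real \<Rightarrow> nat \<Rightarrow> nat \<Rightarrow> (nat \<times> nat) set"
  where "far_pairs x \<xi> s m n =
    {(j, k) \<in> pos_nats \<times> pos_nats. j \<le> m \<and> k \<le> n \<and> norm (x j k - \<xi>) \<ge> s}"

text \<open>The rectangle sizes \<open>(m, n)\<close> for which these pairs have density at least \<open>\<delta>\<close>.\<close>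

definition dense_far_set ::
    "(nat \<Rightarrow> nat \<Rightarrow> 'a::real_normed_vector) \<Rightarrow> 'a \<Rightarrow> real \<Rightarrow> real \<Rightarrow> (nat \<times> nat) set"
  where "dense_far_set x \<xi> s \<delta> =
    {(m, n) \<in> pos_nats \<times> pos_nats. 1 / (real m * real n) * real (card (far_pairs x \<xi> s m n)) \<ge> \<delta>}"

lemma rough_I_statistically_convergent_iff:
  "rough_I_statistically_convergent I r x \<xi> \<longleftrightarrow>
    (\<forall>\<epsilon>>0. \<forall>\<delta>>0. dense_far_set x \<xi> (r + \<epsilon>) \<delta> \<in> I)"
  unfolding rough_I_statistically_convergent_def dense_far_set_def far_pairs_def ..

lemma finite_far_pairs: "finite (far_pairs x \<xi> s m n)"
  by (rule finite_subset[of _ "{..m} \<times> {..n}"]) (auto simp: far_pairs_def)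

lemma far_from_convex_combination:
  fixes y a b :: "'a::real_normed_vector"
  assumes "0 \<le> u" "0 \<le> v" "u + v = 1" "s \<le> norm (y - (u *\<^sub>R a + v *\<^sub>R b))"
  shows "s \<le> norm (y - a) \<or> s \<le> norm (y - b)"
proof (rule ccontr)
  assume "\<not> ?thesis"
  then have "a \<in> ball y s" "b \<in> ball y s"
    by (auto simp: dist_norm)
  then have "u *\<^sub>R a + v *\<^sub>R b \<in> ball y s"
    using assms(1-3) by (rule convexD[OF convex_ball])
  with assms(4) show False
    by (simp add: dist_norm)
qed

lemma far_pairs_convex_combination:
  assumes "0 \<le> u" "0 \<le> v" "u + v = 1"
  shows "far_pairs x (u *\<^sub>R a + v *\<^sub>R b) s m n \<subseteq> far_pairs x a s m n \<union> far_pairs x b s m n"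
  using far_from_convex_combination[OF assms] unfolding far_pairs_def by blast

lemma dense_far_set_convex_combination:
  assumes "0 \<le> u" "0 \<le> v" "u + v = 1"
  shows "dense_far_set x (u *\<^sub>R a + v *\<^sub>R b) s \<delta>
           \<subseteq> dense_far_set x a s (\<delta> / 2) \<union> dense_far_set x b s (\<delta> / 2)"
proof (rule subrelI)
  fix m n
  let ?c = "u *\<^sub>R a + v *\<^sub>R b"
  let ?d = "\<lambda>\<xi>. 1 / (real m * real n) * real (card (far_pairs x \<xi> s m n))"
  assume "(m, n) \<in> dense_far_set x ?c s \<delta>"
  then have pos: "m \<in> pos_nats" "n \<in> pos_nats" and dense: "\<delta> \<le> ?d ?c"
    by (auto simp: dense_far_set_def)
  have "card (far_pairs x ?c s m n) \<le> card (far_pairs x a s m n \<union> far_pairs x b s m n)"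
    by (intro card_mono far_pairs_convex_combination assms) (simp add: finite_far_pairs)
  also have "\<dots> \<le> card (far_pairs x a s m n) + card (far_pairs x b s m n)"
    by (rule card_Un_le)
  finally have "real (card (far_pairs x ?c s m n))
      \<le> real (card (far_pairs x a s m n)) + real (card (far_pairs x b s m n))"
    by linarith
  then have "?d ?c \<le> 1 / (real m * real n) *
      (real (card (far_pairs x a s m n)) + real (card (far_pairs x b s m n)))"
    by (rule mult_left_mono) simp
  also have "\<dots> = ?d a + ?d b"
    by (rule distrib_left)
  finally have "\<delta> / 2 \<le> ?d a \<or> \<delta> / 2 \<le> ?d b"
    using dense by linarith
  with pos show "(m, n) \<in> dense_far_set x a s (\<delta> / 2) \<union> dense_far_set x b s (\<delta> / 2)"
    by (auto simp: dense_far_set_def)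
qed

lemma convex_I_st_LIM:
  assumes "set_ideal_on S I"
  shows "convex (I_st_LIM I r (x :: nat \<Rightarrow> nat \<Rightarrow> 'a::real_normed_vector))"
proof (rule convexI)
  fix a b :: 'a and u v :: real
  assume lim: "a \<in> I_st_LIM I r x" "b \<in> I_st_LIM I r x"
    and uv: "0 \<le> u" "0 \<le> v" "u + v = 1"
  have "dense_far_set x (u *\<^sub>R a + v *\<^sub>R b) (r + \<epsilon>) \<delta> \<in> I" if "\<epsilon> > 0" "\<delta> > 0" for \<epsilon> \<delta>
  proof -
    have "dense_far_set x a (r + \<epsilon>) (\<delta> / 2) \<in> I" "dense_far_set x b (r + \<epsilon>) (\<delta> / 2) \<in> I"
      using lim that by (auto simp: I_st_LIM_def rough_I_statistically_convergent_iff)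
    then have "dense_far_set x a (r + \<epsilon>) (\<delta> / 2) \<union> dense_far_set x b (r + \<epsilon>) (\<delta> / 2) \<in> I"
      using assms unfolding set_ideal_on_def by meson
    then show ?thesis
      using dense_far_set_convex_combination[OF uv] assms unfolding set_ideal_on_def by meson
  qed
  then show "u *\<^sub>R a + v *\<^sub>R b \<in> I_st_LIM I r x"
    by (simp add: I_st_LIM_def rough_I_statistically_convergent_iff)
qed

theorem theorem3p6:
  fixes I :: "(nat \<times> nat) set set"
    and x :: "nat \<Rightarrow> nat \<Rightarrow> 'a::real_normed_vector"
    and r :: real
  assumes "strongly_admissible_ideal I"
    and "r \<ge> 0"
  shows "convex (I_st_LIM I r x)"
proof (rule convex_I_st_LIM)
  show "set_ideal_on (pos_nats \<times> pos_nats) I"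
    using assms(1) by (simp add: strongly_admissible_ideal_def nontrivial_ideal_on_def)
qed

end
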